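(* Let $\alpha\in(0,1)$ and $\tau\in[0,1]$. Let $D=(X_i,Y_i)_{1\le i\le n}$ consist of $n$ i.i.d. copies of a random variable $(X,Y)$ with values in $\mathbb{R}^d\times\mathbb{R}$, where $(X,Y)$ also denotes a new observation independent of $D$, and let $D_1,D_2$ be an arbitrary partition of $D$ into two disjoint sets. Let $N_\tau=N_{D_1,\tau}=(l_\tau,m_\tau,u_\tau)$ be a neural network fit on $D_1$ by minimizing the level-$\tau$ empirical risk on $D_1$ (defined in the context). For all $(X_i,Y_i)\in D_2$ set $$c_i=\max\left(\frac{m_\tau(X_i)-Y_i}{m_\tau(X_i)-l_\tau(X_i)},\ \frac{Y_i-m_\tau(X_i)}{u_\tau(X_i)-m_\tau(X_i)}\right),$$ let $\hat c=c_{(k)}$ be the $k$th order statistic (the $k$th smallest) of these $c_i$, where $k=\lceil(1-\alpha)(|D_2|+1)\rceil$, and set $$l_\tau^{\hat c}(x)=m_\tau(x)-\hat c\,(m_\tau(x)-l_\tau(x)),\qquad u_\tau^{\hat c}(x)=m_\tau(x)+\hat c\,(u_\tau(x)-m_\tau(x)),$$ $$\Gamma_\alpha^{\hat c}(x)=[l_\tau^{\hat c}(x),u_\tau^{\hat c}(x)].$$ Then $$\mathbb{P}\left(Y\in\Gamma_\alpha^{\hat c}(X)\right)\ge 1-\alpha.$$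
   Context: The probability is over all random variables involved, that is, over both the data $D$ and the new observation $(X,Y)$. $|D'|$ denotes the cardinality of a set $D'$. Networks: a network is a function $N=(l,m,u):\mathbb{R}^d\to\mathbb{R}^3$ with $l(x)\le m(x)\le u(x)$ for all $x\in\mathbb{R}^d$. The remaining network architecture is chosen by the user; it may depend on the data, as long as the dependence is only on $D_1$. Loss: for $\tau\in[0,1]$ and $u\in\mathbb{R}$ let $h_\tau(u)=(\tau-\mathbf{1}_{\{u\le 0\}})u$. The level-$\tau$ loss of $N$ at $(x,y)$ is $$\mathcal{L}_\tau(N(x),y)=h_{\tau/2}(y-l(x))+h_{1/2}(y-m(x))+h_{1-\tau/2}(y-u(x)),$$ and the level-$\tau$ empirical risk of $N$ on $D'\subseteq D$ is $$\mathcal{R}_{D',\tau}(N)=\frac{1}{|D'|}\sum_{(X_i,Y_i)\in D'}\mathcal{L}_\tau(N(X_i),Y_i).$$ $N_{D',\tau}=(l_{D',\tau},m_{D',\tau},u_{D',\tau})$ denotes a network that is fit on $D'$ by minimizing $\mathcal{R}_{D',\tau}(N)$; the subscript $D_1$ is dropped for the network fit on $D_1$. In the trivial case $\tau=0$ one sets $l_0(x)=-\infty$ and $u_0(x)=\infty$ for all $x\in\mathbb{R}^d$. *)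

theory Defs
  imports "HOL-Probability.Probability"
begin

text \<open>A network outputs the triple \<open>(l(x), m(x), u(x))\<close>.\<close>

type_synonym 'd network = "real ^ 'd \<Rightarrow> real \<times> real \<times> real"

definition is_network :: "'d::finite network \<Rightarrow> bool" where
  "is_network N \<longleftrightarrow> (\<forall>x. case N x of (l, m, u) \<Rightarrow> l \<le> m \<and> m \<le> u)"

definition pinball :: "real \<Rightarrow> real \<Rightarrow> real" where
  "pinball \<tau> v = (\<tau> - (if v \<le> 0 then 1 else 0)) * v"

definition net_loss :: "real \<Rightarrow> real \<times> real \<times> real \<Rightarrow> real \<Rightarrow> real" where
  "net_loss \<tau> p y = (case p of (l, m, u) \<Rightarrow>
     pinball (\<tau> / 2) (y - l) + pinball (1 / 2) (y - m) + pinball (1 - \<tau> / 2) (y - u))"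

text \<open>
  A data set is a family of pairs \<open>(X\<^sub>i, Y\<^sub>i)\<close> indexed by a finite set \<open>I\<close>, so repeated
  observations are counted with multiplicity and its cardinality is \<open>card I\<close>.
\<close>

definition subsample :: "nat set \<Rightarrow> (nat \<Rightarrow> 'w \<Rightarrow> 'z) \<Rightarrow> 'w \<Rightarrow> nat \<Rightarrow> 'z" where
  "subsample I D \<omega> = (\<lambda>i\<in>I. D i \<omega>)"

definition emp_risk ::
    "nat set \<Rightarrow> (nat \<Rightarrow> (real ^ 'd) \<times> real) \<Rightarrow> real \<Rightarrow> 'd::finite network \<Rightarrow> real" where
  "emp_risk I z \<tau> N =
     1 / real (card I) * (\<Sum>i\<in>I. net_loss \<tau> (N (fst (z i))) (snd (z i)))"

text \<open>
  The outputs at level \<open>\<tau>\<close>. They are extended reals because at \<open>\<tau> = 0\<close> the outer two are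
  set to \<open>-\<infinity>\<close> and \<open>\<infinity>\<close> instead of being taken from the fitted network.
\<close>

definition net_mid :: "'d::finite network \<Rightarrow> real ^ 'd \<Rightarrow> ereal" where
  "net_mid N x = (case N x of (l, m, u) \<Rightarrow> ereal m)"

definition net_lower :: "real \<Rightarrow> 'd::finite network \<Rightarrow> real ^ 'd \<Rightarrow> ereal" where
  "net_lower \<tau> N x = (if \<tau> = 0 then -\<infinity> else case N x of (l, m, u) \<Rightarrow> ereal l)"

definition net_upper :: "real \<Rightarrow> 'd::finite network \<Rightarrow> real ^ 'd \<Rightarrow> ereal" where
  "net_upper \<tau> N x = (if \<tau> = 0 then \<infinity> else case N x of (l, m, u) \<Rightarrow> ereal u)"

text \<open>
  Division on \<^typ>\<open>ereal\<close> supplies the conventions for degenerate networks: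
  \<open>a / 0\<close> is \<open>\<infinity>\<close>, \<open>0\<close> or \<open>-\<infinity>\<close> according to the sign of \<open>a\<close>, and
  \<open>a / \<infinity> = 0\<close> for finite \<open>a\<close>.
\<close>

definition conf_score :: "real \<Rightarrow> 'd::finite network \<Rightarrow> (real ^ 'd) \<times> real \<Rightarrow> ereal" where
  "conf_score \<tau> N z = (case z of (x, y) \<Rightarrow>
     max ((net_mid N x - ereal y) / (net_mid N x - net_lower \<tau> N x))
         ((ereal y - net_mid N x) / (net_upper \<tau> N x - net_mid N x)))"

text \<open>
  The \<open>k\<close>th smallest value of the family \<open>(c\<^sub>i)\<close>, \<open>i \<in> I\<close>, for \<open>k \<ge> 1\<close>. When there are
  fewer than \<open>k\<close> values it is \<open>\<infinity>\<close>, as is customary in conformal prediction.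
\<close>

definition order_stat :: "nat \<Rightarrow> nat set \<Rightarrow> (nat \<Rightarrow> ereal) \<Rightarrow> ereal" where
  "order_stat k I c =
     (if k \<le> card I then sorted_list_of_multiset (image_mset c (mset_set I)) ! (k - 1) else \<infinity>)"

definition calib_factor ::
    "real \<Rightarrow> real \<Rightarrow> 'd::finite network \<Rightarrow> nat set \<Rightarrow> (nat \<Rightarrow> (real ^ 'd) \<times> real) \<Rightarrow> ereal" where
  "calib_factor \<alpha> \<tau> N I z =
     order_stat (nat \<lceil>(1 - \<alpha>) * (real (card I) + 1)\<rceil>) I (\<lambda>i. conf_score \<tau> N (z i))"

text \<open>
  Multiplication of a factor \<open>c \<ge> 0\<close> and a width \<open>w \<ge> 0\<close>, with \<open>\<infinity> * 0 = 0 * \<infinity> = \<infinity>\<close>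
  in place of the value \<open>0\<close> that \<^typ>\<open>ereal\<close> assigns. An infinite calibration factor
  thus always yields the whole line (also where the uncalibrated band has width zero), and
  an infinite band (\<open>\<tau> = 0\<close>, where all scores vanish) remains the whole line.
\<close>

definition scale_width :: "ereal \<Rightarrow> ereal \<Rightarrow> ereal" where
  "scale_width c w = (if c = \<infinity> \<or> w = \<infinity> then \<infinity> else c * w)"

definition calib_lower :: "real \<Rightarrow> 'd::finite network \<Rightarrow> ereal \<Rightarrow> real ^ 'd \<Rightarrow> ereal" where
  "calib_lower \<tau> N c x = net_mid N x - scale_width c (net_mid N x - net_lower \<tau> N x)"

definition calib_upper :: "real \<Rightarrow> 'd::finite network \<Rightarrow> ereal \<Rightarrow> real ^ 'd \<Rightarrow> ereal" where
  "calib_upper \<tau> N c x = net_mid N x + scale_width c (net_upper \<tau> N x - net_mid N x)"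

definition calib_band :: "real \<Rightarrow> 'd::finite network \<Rightarrow> ereal \<Rightarrow> real ^ 'd \<Rightarrow> real set" where
  "calib_band \<tau> N c x = {y. calib_lower \<tau> N c x \<le> ereal y \<and> ereal y \<le> calib_upper \<tau> N c x}"

end

theory Submission
  imports Defs
begin

text \<open>
  The new observation lies in the calibrated band exactly if its score is at most the calibration
  factor, i.e. if fewer than \<open>k\<close> calibration scores are strictly smaller than it. Given the
  training data, the calibration scores and the new score are exchangeable, so each of these
  \<open>card I\<^sub>2 + 1\<close> scores is equally likely to have fewer than \<open>k\<close> others strictly below it; since at
  least \<open>k\<close> of them always do, this has probability at least \<open>k / (card I\<^sub>2 + 1) \<ge> 1 - \<alpha>\<close>.
\<close>

section \<open>Ranks and order statistics of finite families\<close>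

text \<open>In a sorted list the entries strictly below \<open>s\<close> form an initial segment,
  and position \<open>p\<close>, counted from 0, lies outside it exactly if its length is at most
  \<open>p\<close>.\<close>

lemma sorted_le_nth_iff_length_filter:
  fixes s :: "'a::linorder"
  assumes "sorted xs" "p < length xs"
  shows "s \<le> xs ! p \<longleftrightarrow> length (filter (\<lambda>x. x < s) xs) \<le> p"
proof -
  let ?A = "{q. q < length xs \<and> xs ! q < s}"
  have "card ?A \<le> p" if "s \<le> xs ! p"
  proof -
    have "q < p" if "q \<in> ?A" for q
      using sorted_nth_mono[OF assms(1), of p q] \<open>s \<le> xs ! p\<close> that by fastforce
    then have "?A \<subseteq> {..<p}"
      by blast
    then show ?thesis
      using card_mono[of "{..<p}" ?A] by simp
  qed
  moreover have "p < card ?A" if "xs ! p < s"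
  proof -
    have "{..p} \<subseteq> ?A"
      using assms(2) that sorted_nth_mono[OF assms(1), of _ p] by (auto intro: le_less_trans)
    then show ?thesis
      using card_mono[of ?A "{..p}"] by simp
  qed
  ultimately show ?thesis
    unfolding length_filter_conv_card by (meson leD not_le)
qed

text \<open>Replaces the order statistic by a count, which is insensitive to reordering and copes
  with ties. For \<open>k\<close> above \<open>card I\<close> both sides are true: the statistic is
  infinite and the count is at most \<open>card I\<close>.\<close>

lemma le_order_stat_iff:
  assumes "finite I" "0 < k"
  shows "s \<le> order_stat k I c \<longleftrightarrow> card {i \<in> I. c i < s} < k"
proof (cases "k \<le> card I")
  case True
  let ?xs = "sorted_list_of_multiset (image_mset c (mset_set I))"
  have len: "length ?xs = card I"
    by (metis mset_sorted_list_of_multiset size_image_mset size_mset size_mset_set)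
  have "length (filter (\<lambda>x. x < s) ?xs) = size (filter_mset (\<lambda>x. x < s) (mset ?xs))"
    by (metis mset_filter size_mset)
  also have "\<dots> = card {i \<in> I. c i < s}"
    using assms(1) by (simp add: filter_mset_image_mset)
  \<comment> \<open>List positions start at 0, so the bound on the count is \<open>k - 1\<close>;
    \<open>0 < k\<close> turns "at most \<open>k - 1\<close>" into "less than
    \<open>k\<close>".\<close>
  finally show ?thesis
    using True assms(2) len sorted_le_nth_iff_length_filter[of ?xs "k - 1" s]
    by (auto simp: order_stat_def sorted_sorted_list_of_multiset)
next
  case False
  then show ?thesis
    using card_mono[of I "{i \<in> I. c i < s}"] assms(1) by (auto simp: order_stat_def)
qed

text \<open>Otherwise take an index outside the set with the smallest value. All indices with
  strictly smaller values lie in the set, so there are fewer than \<open>k\<close> of them, and the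
  chosen index belongs to the set after all.\<close>

lemma card_rank_less_ge:
  fixes c :: "'i \<Rightarrow> 'a::linorder"
  assumes "finite J" "k \<le> card J"
  shows "k \<le> card {j \<in> J. card {i \<in> J. c i < c j} < k}"
proof (rule ccontr)
  let ?A = "{j \<in> J. card {i \<in> J. c i < c j} < k}"
  assume less: "\<not> k \<le> card ?A"
  have "J - ?A \<noteq> {}"
  proof
    assume "J - ?A = {}"
    then have "?A = J" by blast
    with less assms(2) show False by simp
  qed
  then obtain j where "is_arg_min c (\<lambda>i. i \<in> J - ?A) j"
    using ex_is_arg_min_if_finite[of "J - ?A" c] assms(1) by blast
  then have j: "j \<in> J - ?A" "\<And>i. i \<in> J - ?A \<Longrightarrow> c j \<le> c i"
    unfolding is_arg_min_linorder by blast+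
  then have "{i \<in> J. c i < c j} \<subseteq> ?A"
    using leD by blast
  then have "card {i \<in> J. c i < c j} \<le> card ?A"
    using assms(1) by (intro card_mono) simp_all
  with less have "card {i \<in> J. c i < c j} < k"
    by linarith
  with j(1) show False by simp
qed

section \<open>Scores and calibrated bands\<close>

lemma net_width_nonneg:
  assumes "is_network N"
  shows "0 \<le> net_mid N x - net_lower \<tau> N x" "0 \<le> net_upper \<tau> N x - net_mid N x"
proof -
  obtain l m u where N: "N x = (l, m, u)" by (cases "N x")
  then have "l \<le> m" "m \<le> u"
    using assms unfolding is_network_def by (metis (mono_tags, lifting) case_prod_conv)+
  then show "0 \<le> net_mid N x - net_lower \<tau> N x" "0 \<le> net_upper \<tau> N x - net_mid N x"
    by (simp_all add: N net_mid_def net_lower_def net_upper_def)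
qed

text \<open>Whichever side of the middle output \<open>y\<close> lies on, one of the two numerators
  is nonnegative, and both widths are.\<close>

lemma conf_score_nonneg:
  assumes "is_network N"
  shows "0 \<le> conf_score \<tau> N z"
proof -
  obtain x y where z: "z = (x, y)" by (cases z)
  obtain m where m: "net_mid N x = ereal m"
    by (cases "N x") (simp add: net_mid_def)
  show ?thesis
  proof (cases "y \<le> m")
    case True
    then have "0 \<le> (net_mid N x - ereal y) / (net_mid N x - net_lower \<tau> N x)"
      using net_width_nonneg[OF assms, where x = x and \<tau> = \<tau>] by (intro zero_le_divide_ereal) (simp_all add: m)
    then show ?thesis by (simp add: z conf_score_def le_max_iff_disj)
  next
    case False
    then have "0 \<le> (ereal y - net_mid N x) / (net_upper \<tau> N x - net_mid N x)"
      using net_width_nonneg[OF assms, where x = x and \<tau> = \<tau>] by (intro zero_le_divide_ereal) (simp_all add: m)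
    then show ?thesis by (simp add: z conf_score_def le_max_iff_disj)
  qed
qed

text \<open>One side of the band. If \<open>c\<close> or \<open>w\<close> is infinite, both
  inequalities hold, by the convention of \<open>scale_width\<close> on the left and because
  \<open>a / \<infinity> = 0\<close> on the right.\<close>

lemma diff_le_scale_width_iff:
  assumes "0 \<le> (w::ereal)" "0 \<le> c"
  shows "ereal a \<le> scale_width c w \<longleftrightarrow> ereal a / w \<le> c"
proof (cases "c = \<infinity> \<or> w = \<infinity>")
  case True
  then show ?thesis
    using assms by (auto simp: scale_width_def)
next
  case False
  then obtain c' w' where cw: "c = ereal c'" "w = ereal w'" "0 \<le> c'" "0 \<le> w'"
    using assms by (cases c; cases w) auto
  show ?thesis
  proof (cases "w' = 0")
    case True
    \<comment> \<open>With zero width and finite \<open>c\<close>, both sides reduce to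
      \<open>a \<le> 0\<close>, since \<open>a / 0\<close> has the sign of \<open>a\<close> and is
      infinite unless \<open>a = 0\<close>.\<close>
    then show ?thesis
      using cw by (cases a "0::real" rule: linorder_cases)
        (auto simp: scale_width_def divide_ereal_def zero_ereal_def)
  next
    case False
    with cw show ?thesis
      by (auto simp: scale_width_def field_simps)
  qed
qed

text \<open>The middle output is finite and can be moved across each endpoint inequality; each then
  bounds one of the two arguments of the maximum in the score.\<close>

lemma mem_calib_band_iff:
  assumes "is_network N" "0 \<le> c"
  shows "y \<in> calib_band \<tau> N c x \<longleftrightarrow> conf_score \<tau> N (x, y) \<le> c"
proof -
  obtain m where m: "net_mid N x = ereal m"
    by (cases "N x") (simp add: net_mid_def)
  define w1 where "w1 = net_mid N x - net_lower \<tau> N x"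
  define w2 where "w2 = net_upper \<tau> N x - net_mid N x"
  have w: "0 \<le> w1" "0 \<le> w2"
    unfolding w1_def w2_def using net_width_nonneg[OF assms(1)] by auto
  have "calib_lower \<tau> N c x \<le> ereal y \<longleftrightarrow> ereal (m - y) \<le> scale_width c w1"
    unfolding calib_lower_def m w1_def[symmetric, unfolded m]
    by (cases "scale_width c w1") auto
  moreover have "ereal y \<le> calib_upper \<tau> N c x \<longleftrightarrow> ereal (y - m) \<le> scale_width c w2"
    unfolding calib_upper_def m w2_def[symmetric, unfolded m]
    by (cases "scale_width c w2") auto
  ultimately show ?thesis
    using diff_le_scale_width_iff[OF w(1) assms(2)] diff_le_scale_width_iff[OF w(2) assms(2)]
    by (simp add: calib_band_def conf_score_def m w1_def w2_def)
qed

section \<open>Measurability and exchangeability\<close>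

lemma conf_score_measurable:
  fixes N :: "'a \<Rightarrow> 'd::finite network"
  assumes "(\<lambda>(a, x). N a x) \<in> borel_measurable (A \<Otimes>\<^sub>M borel)"
  shows "(\<lambda>(a, z). conf_score \<tau> (N a) z) \<in> borel_measurable (A \<Otimes>\<^sub>M borel)"
proof -
  \<comment> \<open>Data points carry the Borel sigma-algebra of the product type, so the
    projections are measurable by continuity.\<close>
  have fst [measurable]: "(fst :: (real ^ 'd) \<times> real \<Rightarrow> _) \<in> borel \<rightarrow>\<^sub>M borel"
    and [measurable]: "(snd :: (real ^ 'd) \<times> real \<Rightarrow> _) \<in> borel \<rightarrow>\<^sub>M borel"
    by (intro borel_measurable_continuous_onI continuous_intros)+
  have *: "(\<lambda>p. (fst p, fst (snd p))) \<in>
      A \<Otimes>\<^sub>M (borel :: ((real ^ 'd) \<times> real) measure) \<rightarrow>\<^sub>M A \<Otimes>\<^sub>M (borel :: (real ^ 'd) measure)"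
    by (intro measurable_Pair measurable_fst measurable_compose[OF measurable_snd fst])
  have N [measurable]: "(\<lambda>p. N (fst p) (fst (snd p))) \<in> A \<Otimes>\<^sub>M (borel :: ((real ^ 'd) \<times> real) measure) \<rightarrow>\<^sub>M borel"
    using measurable_compose[OF * assms] by simp
  have [measurable]: "(fst :: real \<times> real \<times> real \<Rightarrow> _) \<in> borel \<rightarrow>\<^sub>M borel"
      "(\<lambda>p :: real \<times> real \<times> real. fst (snd p)) \<in> borel \<rightarrow>\<^sub>M borel"
      "(\<lambda>p :: real \<times> real \<times> real. snd (snd p)) \<in> borel \<rightarrow>\<^sub>M borel"
    by (intro borel_measurable_continuous_onI continuous_intros)+
  show ?thesis
    unfolding conf_score_def net_mid_def net_lower_def net_upper_def split_beta
    by (cases "\<tau> = 0") measurable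
qed

text \<open>Coordinates in \<open>I\<close> are the training data, those in \<open>J\<close> the
  exchangeable rest. The events "\<open>j\<close> has fewer than \<open>k\<close> scores strictly
  below its own" are equally likely by symmetry, and at least \<open>k\<close> of them occur at
  every point, so \<open>k\<close> is at most the expected number, \<open>card J\<close> times the
  probability for \<open>a\<close>.\<close>

lemma PiM_rank_less_prob_ge:
  fixes s :: "('i \<Rightarrow> 'z) \<Rightarrow> 'z \<Rightarrow> ereal"
  assumes P: "prob_space P" and J: "finite J" "J \<inter> I = {}" "a \<in> J" and k: "k \<le> card J"
    and s: "(\<lambda>(f, z). s f z) \<in> borel_measurable ((\<Pi>\<^sub>M i\<in>I. P) \<Otimes>\<^sub>M P)"
  defines "Q \<equiv> (\<Pi>\<^sub>M i\<in>I \<union> J. P)"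
  shows "real k / real (card J) \<le> measure Q {f \<in> space Q.
      card {i \<in> J. s (restrict f I) (f i) < s (restrict f I) (f a)} < k}"
proof -
  interpret Q: prob_space Q
    unfolding Q_def using P by (intro prob_space_PiM)
  define E where "E j = {f \<in> space Q.
      card {i \<in> J. s (restrict f I) (f i) < s (restrict f I) (f j)} < k}" for j
  have meas [measurable]: "(\<lambda>f. s (restrict f I) (f i)) \<in> borel_measurable Q" if "i \<in> J" for i
  proof -
    have "(\<lambda>f. (restrict f I, f i)) \<in> Q \<rightarrow>\<^sub>M (\<Pi>\<^sub>M i\<in>I. P) \<Otimes>\<^sub>M P"
      unfolding Q_def using that by (intro measurable_Pair measurable_restrict_subset) auto
    from measurable_compose[OF this s] show ?thesis by simp
  qed
  have E [measurable]: "E j \<in> sets Q" if "j \<in> J" for j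
  proof -
    \<comment> \<open>As a finite sum of indicators of comparisons, the cardinality is visibly
      measurable.\<close>
    have "E j = {f \<in> space Q. (\<Sum>i\<in>J. if s (restrict f I) (f i) < s (restrict f I) (f j)
        then 1 else 0 :: nat) < k}"
      using J(1) by (simp add: E_def sum.If_cases Int_def)
    moreover have "\<dots> \<in> sets Q"
      using that by measurable
    ultimately show ?thesis by simp
  qed
  have swap: "measure Q (E j) = measure Q (E a)" if j: "j \<in> J" for j
  proof -
    \<comment> \<open>Transposing \<open>a\<close> and \<open>j\<close> preserves \<open>Q\<close> and fixes the coordinates in \<open>I\<close>, on which the score depends.\<close>
    define t where "t = Transposition.transpose a j"
    define T where "T f = (\<lambda>i\<in>I \<union> J. f (t i))" for f :: "'i \<Rightarrow> 'z"
    have t_mem: "t i \<in> J \<longleftrightarrow> i \<in> J" "t i \<in> I \<union> J \<longleftrightarrow> i \<in> I \<union> J" for i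
      using j J(3) by (auto simp: t_def Transposition.transpose_def)
    have t_I: "t i = i" if "i \<in> I" for i
      using that j J by (auto simp: t_def Transposition.transpose_def)
    have tt: "t (t i) = i" for i by (simp add: t_def)
    have "inj_on t (I \<union> J)" by (simp add: t_def)
    then have distr: "distr Q Q T = Q"
      unfolding Q_def T_def using P t_mem by (intro distr_PiM_reindex) auto
    have T [measurable]: "T \<in> Q \<rightarrow>\<^sub>M Q"
      unfolding Q_def T_def using t_mem
      by (intro measurable_restrict measurable_component_singleton) auto
    have "T -` E j \<inter> space Q = E a"
    proof (intro set_eqI)
      fix f
      have r: "restrict (T f) I = restrict f I"
        by (auto simp: T_def t_I restrict_def)
      have T_J: "T f i = f (t i)" if "i \<in> J" for i
        using that by (simp add: T_def)
      have "card {i \<in> J. s (restrict f I) (T f i) < s (restrict f I) (T f j)} =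
          card {i \<in> J. s (restrict f I) (f i) < s (restrict f I) (f a)}"
      \<comment> \<open>The involution \<open>t\<close> maps each of the two index sets into the
        other.\<close>
      proof (rule bij_betw_same_card[of t], rule bij_betw_byWitness[where f' = t])
        have tj: "T f j = f a" using T_J[OF j] by (simp add: t_def)
        show "t ` {i \<in> J. s (restrict f I) (T f i) < s (restrict f I) (T f j)}
            \<subseteq> {i \<in> J. s (restrict f I) (f i) < s (restrict f I) (f a)}"
          by (auto simp: t_mem T_J tj)
        show "t ` {i \<in> J. s (restrict f I) (f i) < s (restrict f I) (f a)}
            \<subseteq> {i \<in> J. s (restrict f I) (T f i) < s (restrict f I) (T f j)}"
          by (auto simp: t_mem T_J tj tt)
      qed (auto simp: tt)
      then show "f \<in> T -` E j \<inter> space Q \<longleftrightarrow> f \<in> E a"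
        using measurable_space[OF T, of f] by (auto simp: E_def r)
    qed
    then show ?thesis
      using measure_distr[OF T, of "E j"] E[OF j] by (simp add: distr)
  qed
  have int: "integrable Q (indicator (E j) :: _ \<Rightarrow> real)" if "j \<in> J" for j
    using E[OF that] by (simp add: Q.emeasure_finite less_top[symmetric])
  have "real k \<le> (\<integral>f. (\<Sum>j\<in>J. indicator (E j) f) \<partial>Q)"
  proof (rule Q.integral_ge_const)
    show "integrable Q (\<lambda>f. \<Sum>j\<in>J. indicator (E j) f :: real)"
      by (intro Bochner_Integration.integrable_sum int)
    have "real k \<le> (\<Sum>j\<in>J. indicator (E j) f)" if "f \<in> space Q" for f
    proof -
      have "k \<le> card {j \<in> J. f \<in> E j}"
        using card_rank_less_ge[OF J(1) k, of "\<lambda>i. s (restrict f I) (f i)"] that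
        by (simp add: E_def)
      then show ?thesis
        using J(1) by (simp add: indicator_def sum.If_cases Int_def)
    qed
    then show "AE f in Q. real k \<le> (\<Sum>j\<in>J. indicator (E j) f)" by simp
  qed
  also have "\<dots> = (\<Sum>j\<in>J. measure Q (E j))"
    using sets.sets_into_space[OF E]
    by (subst Bochner_Integration.integral_sum[OF int]) (auto simp: Int_absorb2 intro!: sum.cong)
  also have "\<dots> = real (card J) * measure Q (E a)"
    using swap by simp
  finally show ?thesis
    unfolding E_def using J by (auto simp: divide_simps card_gt_0_iff mult.commute)
qed

section \<open>Coverage of the calibrated band\<close>

theorem theorem1:
  fixes M :: "'w measure"
    and X :: "'w \<Rightarrow> real ^ 'd::finite" and Y :: "'w \<Rightarrow> real"
    and D :: "nat \<Rightarrow> 'w \<Rightarrow> (real ^ 'd) \<times> real"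
    and n :: nat and I\<^sub>1 I\<^sub>2 :: "nat set"
    and \<alpha> \<tau> :: real
    and arch :: "(nat \<Rightarrow> (real ^ 'd) \<times> real) \<Rightarrow> 'd network set"
    and net :: "(nat \<Rightarrow> (real ^ 'd) \<times> real) \<Rightarrow> 'd network"
  assumes "0 < \<alpha>" "\<alpha> < 1" and "0 \<le> \<tau>" "\<tau> \<le> 1"
    and "prob_space M"
    and iid: "prob_space.indep_vars M (\<lambda>_. borel) (D(0 := (\<lambda>\<omega>. (X \<omega>, Y \<omega>)))) {0..n}"
      "\<And>i. i \<in> {1..n} \<Longrightarrow> distr M borel (D i) = distr M borel (\<lambda>\<omega>. (X \<omega>, Y \<omega>))"
    and partition: "I\<^sub>1 \<union> I\<^sub>2 = {1..n}" "I\<^sub>1 \<inter> I\<^sub>2 = {}"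
    and arch: "\<And>\<omega> N. \<omega> \<in> space M \<Longrightarrow> N \<in> arch (subsample I\<^sub>1 D \<omega>) \<Longrightarrow> is_network N"
    and fit: "\<And>\<omega>. \<omega> \<in> space M \<Longrightarrow>
      is_arg_min (emp_risk I\<^sub>1 (subsample I\<^sub>1 D \<omega>) \<tau>) (\<lambda>N. N \<in> arch (subsample I\<^sub>1 D \<omega>)) (net (subsample I\<^sub>1 D \<omega>))"
    and net_measurable:
      "(\<lambda>(z, x). net z x) \<in> borel_measurable ((\<Pi>\<^sub>M i\<in>I\<^sub>1. borel) \<Otimes>\<^sub>M borel)"
  shows "measure M {\<omega> \<in> space M. Y \<omega> \<in> calib_band \<tau> (net (subsample I\<^sub>1 D \<omega>))
      (calib_factor \<alpha> \<tau> (net (subsample I\<^sub>1 D \<omega>)) I\<^sub>2 (subsample I\<^sub>2 D \<omega>)) (X \<omega>)} \<ge> 1 - \<alpha>"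
proof -
  interpret prob_space M by fact
  define Z where "Z = D(0 := (\<lambda>\<omega>. (X \<omega>, Y \<omega>)))"
  define P where "P = distr M borel (Z 0)"
  define F where "F \<omega> = (\<lambda>i\<in>{0..n}. Z i \<omega>)" for \<omega>
  \<comment> \<open>Index 0 carries the new observation, which joins the calibration sample; this is
    the source of the \<open>+ 1\<close> in \<open>k\<close>.\<close>
  define J where "J = insert 0 I\<^sub>2"
  define k where "k = nat \<lceil>(1 - \<alpha>) * (real (card I\<^sub>2) + 1)\<rceil>"
  define s where "s f = conf_score \<tau> (net f)" for f
  have sub: "I\<^sub>1 \<subseteq> {1..n}" "I\<^sub>2 \<subseteq> {1..n}"
    using partition(1) by blast+
  then have I: "0 \<notin> I\<^sub>1" "0 \<notin> I\<^sub>2" "finite I\<^sub>2"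
    by (auto intro: finite_subset)
  have "{0..n} = insert 0 {1..n}"
    by auto
  then have IJ: "I\<^sub>1 \<union> J = {0..n}" "J \<inter> I\<^sub>1 = {}"
    using partition I(1) by (auto simp: J_def simp del: atLeastAtMost_iff)
  have J: "finite J" "card J = card I\<^sub>2 + 1"
    using I by (simp_all add: J_def)
  have rv: "random_variable borel (Z i)" if "i \<in> {0..n}" for i
    using iid(1) that by (simp add: indep_vars_def Z_def)
  have P: "prob_space P"
    unfolding P_def by (intro prob_space_distr rv) simp
  have Z: "distr M borel (Z i) = P" if "i \<in> {0..n}" for i
    using iid(2)[of i] that by (cases "i = 0") (auto simp: P_def Z_def)
  \<comment> \<open>Independence makes the joint law a product; identical distribution then makes
    every factor equal to \<open>P\<close>.\<close>
  have "distr M (\<Pi>\<^sub>M i\<in>{0..n}. borel) F = (\<Pi>\<^sub>M i\<in>{0..n}. distr M borel (Z i))"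
    using indep_vars_iff_distr_eq_PiM'[of "{0..n}" Z "\<lambda>_. borel"] rv iid(1)
    by (simp add: Z_def[symmetric] F_def[abs_def])
  also have "\<dots> = (\<Pi>\<^sub>M i\<in>I\<^sub>1 \<union> J. P)"
    unfolding IJ by (intro PiM_cong Z) auto
  finally have distr: "distr M (\<Pi>\<^sub>M i\<in>{0..n}. borel) F = (\<Pi>\<^sub>M i\<in>I\<^sub>1 \<union> J. P)" .
  have F: "F \<in> M \<rightarrow>\<^sub>M (\<Pi>\<^sub>M i\<in>{0..n}. borel)"
    unfolding F_def[abs_def] by (intro measurable_restrict rv)
  \<comment> \<open>The value \<open>k = card J\<close> can occur; it exceeds
    \<open>card I\<^sub>2\<close>, and the calibration factor is then infinite.\<close>
  have k: "0 < k" "k \<le> card J" "(1 - \<alpha>) * real (card J) \<le> real k"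
  proof -
    have "0 < (1 - \<alpha>) * (real (card I\<^sub>2) + 1)"
      using assms(2) by simp
    then show "0 < k" by (simp add: k_def)
    have "(1 - \<alpha>) * (real (card I\<^sub>2) + 1) \<le> 1 * (real (card I\<^sub>2) + 1)"
      using assms(1) by (intro mult_right_mono) auto
    then show "k \<le> card J"
      by (simp add: k_def J nat_le_iff ceiling_le_iff add.commute)
    show "(1 - \<alpha>) * real (card J) \<le> real k"
      unfolding k_def J by (rule order_trans[OF _ real_nat_ceiling_ge]) (simp add: add.commute)
  qed
  define E where "E = {f \<in> space (\<Pi>\<^sub>M i\<in>I\<^sub>1 \<union> J. P).
      card {i \<in> J. s (restrict f I\<^sub>1) (f i) < s (restrict f I\<^sub>1) (f 0)} < k}"
  have sets_P: "sets P = sets borel"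
    by (simp add: P_def)
  have "(\<lambda>(f, z). s f z) \<in> borel_measurable ((\<Pi>\<^sub>M i\<in>I\<^sub>1. borel) \<Otimes>\<^sub>M borel)"
    unfolding s_def using net_measurable by (rule conf_score_measurable)
  also have "borel_measurable ((\<Pi>\<^sub>M i\<in>I\<^sub>1. borel) \<Otimes>\<^sub>M borel) =
      borel_measurable ((\<Pi>\<^sub>M i\<in>I\<^sub>1. P) \<Otimes>\<^sub>M P)"
    by (intro measurable_cong_sets sets_pair_measure_cong sets_PiM_cong) (simp_all add: sets_P)
  finally have s: "(\<lambda>(f, z). s f z) \<in> borel_measurable ((\<Pi>\<^sub>M i\<in>I\<^sub>1. P) \<Otimes>\<^sub>M P)" .
  note E = PiM_rank_less_prob_ge[OF P J(1) IJ(2) _ k(2) s, of 0, folded E_def]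
  have E_eq: "{\<omega> \<in> space M. Y \<omega> \<in> calib_band \<tau> (net (subsample I\<^sub>1 D \<omega>))
      (calib_factor \<alpha> \<tau> (net (subsample I\<^sub>1 D \<omega>)) I\<^sub>2 (subsample I\<^sub>2 D \<omega>)) (X \<omega>)} =
      F -` E \<inter> space M"
  proof (intro set_eqI)
    fix \<omega>
    let ?N = "net (subsample I\<^sub>1 D \<omega>)"
    let ?c = "order_stat k I\<^sub>2 (\<lambda>i. conf_score \<tau> ?N (subsample I\<^sub>2 D \<omega> i))"
    show "\<omega> \<in> {\<omega> \<in> space M. Y \<omega> \<in> calib_band \<tau> (net (subsample I\<^sub>1 D \<omega>))
      (calib_factor \<alpha> \<tau> (net (subsample I\<^sub>1 D \<omega>)) I\<^sub>2 (subsample I\<^sub>2 D \<omega>)) (X \<omega>)} \<longleftrightarrow>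
      \<omega> \<in> F -` E \<inter> space M"
    proof (cases "\<omega> \<in> space M")
      case True
      \<comment> \<open>A minimizer belongs to the architecture class, whose members are
        networks.\<close>
      have N: "is_network ?N"
        using fit[OF True] arch[OF True] by (auto simp: is_arg_min_def)
      have F_space: "F \<omega> \<in> space (\<Pi>\<^sub>M i\<in>I\<^sub>1 \<union> J. P)"
        using measurable_space[OF F True] by (simp add: distr[symmetric])
      have F_I\<^sub>1: "restrict (F \<omega>) I\<^sub>1 = subsample I\<^sub>1 D \<omega>"
      proof
        fix i
        show "restrict (F \<omega>) I\<^sub>1 i = subsample I\<^sub>1 D \<omega> i"
          using sub(1) by (cases "i \<in> I\<^sub>1") (auto simp: F_def Z_def subsample_def)
      qed
      have F_0: "F \<omega> 0 = (X \<omega>, Y \<omega>)"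
        by (simp add: F_def Z_def)
      have F_I\<^sub>2: "F \<omega> i = subsample I\<^sub>2 D \<omega> i" if "i \<in> I\<^sub>2" for i
        using that sub(2) by (auto simp: F_def Z_def subsample_def)
      \<comment> \<open>Index 0 drops out because no score is strictly below itself.\<close>
      have "{i \<in> J. s (restrict (F \<omega>) I\<^sub>1) (F \<omega> i) < s (restrict (F \<omega>) I\<^sub>1) (F \<omega> 0)} =
          {i \<in> I\<^sub>2. conf_score \<tau> ?N (subsample I\<^sub>2 D \<omega> i) < conf_score \<tau> ?N (X \<omega>, Y \<omega>)}"
        by (auto simp: J_def s_def F_I\<^sub>1 F_0 F_I\<^sub>2)
      then have "F \<omega> \<in> E \<longleftrightarrow> card {i \<in> I\<^sub>2.
          conf_score \<tau> ?N (subsample I\<^sub>2 D \<omega> i) < conf_score \<tau> ?N (X \<omega>, Y \<omega>)} < k"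
        using F_space by (simp add: E_def)
      also have "\<dots> \<longleftrightarrow> conf_score \<tau> ?N (X \<omega>, Y \<omega>) \<le> ?c"
        using I k by (subst le_order_stat_iff) auto
      also have "\<dots> \<longleftrightarrow> Y \<omega> \<in> calib_band \<tau> ?N ?c (X \<omega>)"
      proof (rule mem_calib_band_iff[OF N, symmetric])
        \<comment> \<open>Nonnegativity of the factor is the counting criterion at level 0: no score
          is negative, and \<open>0 < k\<close>.\<close>
        have "{i \<in> I\<^sub>2. conf_score \<tau> ?N (subsample I\<^sub>2 D \<omega> i) < 0} = {}"
          using conf_score_nonneg[OF N] by (auto simp: not_less)
        then show "0 \<le> ?c"
          unfolding le_order_stat_iff[OF I(3) k(1)] using k(1) by (simp only: card.empty)
      qed
      finally show ?thesis
        using True by (simp add: calib_factor_def k_def)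
    qed simp
  qed
  have "0 < real k / real (card J)"
    using k J by simp
  also have E_ge: "\<dots> \<le> measure (\<Pi>\<^sub>M i\<in>I\<^sub>1 \<union> J. P) E"
    using E by (simp add: J_def)
  \<comment> \<open>Non-measurable sets have measure \<open>0\<close>.\<close>
  finally have "E \<in> sets (\<Pi>\<^sub>M i\<in>I\<^sub>1 \<union> J. P)"
    using measure_notin_sets by fastforce
  then have E_F: "measure (\<Pi>\<^sub>M i\<in>I\<^sub>1 \<union> J. P) E = measure M (F -` E \<inter> space M)"
    using F by (simp add: distr[symmetric] measure_distr)
  have "1 - \<alpha> \<le> real k / real (card J)"
    using k(3) J(2) by (simp add: field_simps)
  with E_ge show ?thesis
    unfolding E_eq E_F by linarith
qed

end
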